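(* Let $a\in(0,1)$, and let $V$ and $W$ be dense, countable, i.d.f. subsets of $c_a$ satisfying the i.o.p. If $G$ and $H$ are g.e.c. geometric $1$-graphs with vertex sets $V$ and $W$, respectively, then $G\cong H$.
   Context: $c_a$ is the set of real sequences $x=(x_n)_{n\in\mathbb N}$ converging to $a$, with metric from the sup norm $\|x\|=\sup_n|x_n|$. For $t\in\mathbb R$, $\{t\}=t-\lfloor t\rfloor$. A subset $A\subseteq c_a$ is i.d.f. if for all $n\in\mathbb N$: $x_n\notin\mathbb Z$ for all $x\in A$ and $x_n-y_n\notin\mathbb Z$ for distinct $x,y\in A$. A countable i.d.f. set $\{x^{(1)},x^{(2)},\ldots\}\subseteq c_a$ has the independent order property (i.o.p.) if for any finite sub-collection $x^{(i_1)},\ldots,x^{(i_k)}$ and any finite collection of orderings $\prec_1,\ldots,\prec_N$ of $\{1,\ldots,k\}$, there exist distinct positions $j_1,\ldots,j_N\in\mathbb N$ such that $m\prec_\ell n$ if and only if $\{x^{(i_m)}_{j_\ell}\}<\{x^{(i_n)}_{j_\ell}\}$. For $x$ in a normed space (or a subset of one), $B_1(x)=\{u\colon\|u-x\|<1\}$. A graph $G$ with vertex set $V$ in such a space is g.e.c. if for every $\delta'\in(0,1)$, every $x\in V$, and all disjoint finite $A,B\subseteq V$ with $A\cup B\subseteq B_1(x)$, there is $z\in V\setminus(A\cup B\cup\{x\})$ adjacent to every vertex of $A$ and to no vertex of $B$, with $A\cup B\subseteq B_1(z)$ and $\|x-z\|<\delta'$. $G$ has threshold $1$ if $\|u-v\|<1$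 for every edge $uv$. A geometric $1$-graph is a countable graph that is g.e.c. and has threshold $1$. *)

theory Defs
  imports
    "HOL-Analysis.Analysis"
    "Graph_Theory.Pair_Digraph"
    "Graph_Theory.Digraph_Isomorphism"
begin

text \<open>
  As every real sequence is continuous and every convergent one is bounded, the real sequences
  converging to \<open>a\<close> are elements of \<open>nat \<Rightarrow>\<^sub>C real\<close>, whose library norm is the supremum norm.
\<close>

definition c_seq :: "real \<Rightarrow> (nat \<Rightarrow>\<^sub>C real) set" where
  "c_seq a = {x. (\<lambda>n. apply_bcontfun x n) \<longlonglongrightarrow> a}"

definition idf :: "(nat \<Rightarrow>\<^sub>C real) set \<Rightarrow> bool" where
  "idf A \<longleftrightarrow>
    (\<forall>n. (\<forall>x\<in>A. apply_bcontfun x n \<notin> \<int>) \<and>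
         (\<forall>x\<in>A. \<forall>y\<in>A. x \<noteq> y \<longrightarrow> apply_bcontfun x n - apply_bcontfun y n \<notin> \<int>))"

text \<open>
  The function \<open>x\<close> lists the members of a finite sub-collection without repetition.  The
  orderings \<open>R 1, \<dots>, R N\<close> are strict linear orders, as fractional parts at a fixed position
  are pairwise different in an i.d.f. set; they need not be pairwise different, whereas the
  positions \<open>j 1, \<dots>, j N\<close> realising them do.
\<close>

definition iop :: "(nat \<Rightarrow>\<^sub>C real) set \<Rightarrow> bool" where
  "iop A \<longleftrightarrow>
    (\<forall>(k::nat) (x :: nat \<Rightarrow> (nat \<Rightarrow>\<^sub>C real)) (N::nat) (R :: nat \<Rightarrow> nat rel).
       x ` {1..k} \<subseteq> A \<and> inj_on x {1..k} \<and>
       (\<forall>l\<in>{1..N}. R l \<subseteq> {1..k} \<times> {1..k} \<and> strict_linear_order_on {1..k} (R l))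
       \<longrightarrow> (\<exists>j :: nat \<Rightarrow> nat. inj_on j {1..N} \<and>
             (\<forall>l\<in>{1..N}. \<forall>m\<in>{1..k}. \<forall>n\<in>{1..k}.
                (m, n) \<in> R l \<longleftrightarrow>
                frac (apply_bcontfun (x m) (j l)) < frac (apply_bcontfun (x n) (j l)))))"

text \<open>
  A graph, not necessarily finite, is a symmetric digraph without loops
  (\<open>pair_bidirected_digraph\<close>); an undirected edge \<open>uv\<close> is represented by the two arcs
  \<open>(u, v)\<close> and \<open>(v, u)\<close>.
\<close>

definition gec :: "'a::real_normed_vector pair_pre_digraph \<Rightarrow> bool" where
  "gec G \<longleftrightarrow>
    (\<forall>\<delta>'\<in>{0<..<1}. \<forall>x\<in>pverts G. \<forall>A B.
       finite A \<and> finite B \<and> A \<subseteq> pverts G \<and> B \<subseteq> pverts G \<and> A \<inter> B = {} \<and> A \<union> B \<subseteq> ball x 1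
       \<longrightarrow> (\<exists>z \<in> pverts G - (A \<union> B \<union> {x}).
             (\<forall>u\<in>A. (z, u) \<in> parcs G) \<and> (\<forall>u\<in>B. (z, u) \<notin> parcs G) \<and>
             A \<union> B \<subseteq> ball z 1 \<and> norm (x - z) < \<delta>'))"

definition threshold_1 :: "'a::real_normed_vector pair_pre_digraph \<Rightarrow> bool" where
  "threshold_1 G \<longleftrightarrow> (\<forall>(u, v) \<in> parcs G. norm (u - v) < 1)"

definition geometric_1_graph :: "'a::real_normed_vector pair_pre_digraph \<Rightarrow> bool" where
  "geometric_1_graph G \<longleftrightarrow>
    pair_bidirected_digraph G \<and> countable (pverts G) \<and> gec G \<and> threshold_1 G"

end

theory Submission
  imports Defs
begin

text \<open>
  Back and forth.  For sequences in \<open>c_seq a\<close> the supremum in \<open>norm (x - y)\<close> is attained, so whether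
  \<open>norm (x - y) < 1\<close> is decided by the floors of the coordinates and the order of their
  fractional parts; as \<open>a\<close> lies strictly between 0 and 1, all but finitely many floors vanish.  A
  finite partial isomorphism is therefore carried along with a finite partial injection between
  the coordinates under which these data correspond.  Given a new vertex \<open>v\<close>, the i.o.p. supplies
  partners for the finitely many further coordinates where its floor is nonzero.  The admissible
  images of \<open>v\<close> then contain a neighbourhood in \<open>c_seq a\<close>, hence a vertex \<open>x\<close> by density, and
  the g.e.c. property moves \<open>x\<close> slightly to a vertex with the required adjacencies.
\<close>

section \<open>Generic chains and isomorphisms of digraphs\<close>

text \<open>Enumerate \<open>D\<close> and enter its \<open>n\<close>-th member at step
  \<open>n + 1\<close>, as in the Rasiowa-Sikorski lemma. Putting the requirements of both sides
  into one \<open>D\<close> replaces the alternation of back and forth.\<close>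

lemma countable_generic_chain:
  fixes P :: "'a set set"
  assumes "countable D" and "r \<in> P"
    and ext: "\<And>d r. d \<in> D \<Longrightarrow> r \<in> P \<Longrightarrow> \<exists>s\<in>P \<inter> d. r \<subseteq> s"
  obtains C :: "nat \<Rightarrow> 'a set"
  where "incseq C" and "range C \<subseteq> P" and "\<And>d. d \<in> D \<Longrightarrow> range C \<inter> d \<noteq> {}"
proof (cases "D = {}")
  case True
  show ?thesis
    by (rule that[of "\<lambda>_. r"]) (use True assms(2) in \<open>auto simp: incseq_def\<close>)
next
  case False
  define d where "d = from_nat_into D"
  have d: "range d = D"
    using False assms(1) by (simp add: d_def range_from_nat_into)
  have "\<exists>C. \<forall>n. C n \<in> P \<and> C n \<subseteq> C (Suc n) \<and> C (Suc n) \<in> d n"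
    using dependent_nat_choice[of "\<lambda>_ r. r \<in> P" "\<lambda>n r s. r \<subseteq> s \<and> s \<in> d n"] assms(2) ext d
    by (metis IntD1 IntD2 rangeI)
  then obtain C where C: "\<And>n. C n \<in> P" "\<And>n. C n \<subseteq> C (Suc n)" "\<And>n. C (Suc n) \<in> d n"
    by blast
  show ?thesis
  proof (rule that)
    show "incseq C" using C(2) by (rule incseq_SucI)
    show "range C \<subseteq> P" using C(1) by blast
    show "range C \<inter> e \<noteq> {}" if "e \<in> D" for e
      using that C(3) d by blast
  qed
qed

text \<open>Arcs are pairs of vertices, so the arc map is forced to be \<open>map_prod f f\<close>;
  it is injective on arcs because well-formedness places them in
  \<open>pverts G \<times> pverts G\<close>.\<close>

lemma digraph_iso_with_projI:
  assumes "pair_wf_digraph G" and "pair_wf_digraph H" and f: "bij_betw f (pverts G) (pverts H)"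
    and arcs: "\<And>u v. u \<in> pverts G \<Longrightarrow> v \<in> pverts G \<Longrightarrow> (u, v) \<in> parcs G \<longleftrightarrow> (f u, f v) \<in> parcs H"
  shows "digraph_iso (with_proj G) (with_proj H)"
proof -
  interpret G: pair_wf_digraph G by fact
  interpret H: pair_wf_digraph H by fact
  define h where "h = \<lparr>iso_verts = f, iso_arcs = map_prod f f, iso_head = snd, iso_tail = fst\<rparr>"
  have sub: "parcs G \<subseteq> pverts G \<times> pverts G"
    by (auto dest: G.in_arcsD1 G.in_arcsD2)
  have inj: "inj_on f (pverts G)" and img: "f ` pverts G = pverts H"
    using f by (auto simp: bij_betw_def)
  have "inj_on (map_prod f f) (parcs G)"
    using inj sub by (intro inj_on_subset[OF map_prod_inj_on]) auto
  then have "pre_digraph.digraph_isomorphism (with_proj G) h"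
    using inj G.wf_digraph_axioms by (auto simp: pre_digraph.digraph_isomorphism_def h_def)
  moreover have "map_prod f f ` parcs G = parcs H"
  proof (intro equalityI subrelI)
    fix u v assume "(u, v) \<in> map_prod f f ` parcs G"
    then show "(u, v) \<in> parcs H" using sub arcs by auto
  next
    fix u v assume uv: "(u, v) \<in> parcs H"
    then obtain u' v' where "u = f u'" "v = f v'" "u' \<in> pverts G" "v' \<in> pverts G"
      using img by (metis H.in_arcsD1 H.in_arcsD2 imageE)
    then show "(u, v) \<in> map_prod f f ` parcs G"
      using arcs uv by (auto intro!: image_eqI[where x = "(u', v')"])
  qed
  then have "with_proj H = app_iso h (with_proj G)"
    using img by (intro pre_digraph.equality) (auto simp: app_iso_def h_def)
  ultimately show ?thesis
    unfolding digraph_iso_def by blast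
qed

section \<open>Floors, fractional parts and the supremum norm\<close>

text \<open>The difference of the floors decides alone unless it is 1 or -1; then the number with
  the larger floor must have the smaller fractional part.\<close>

lemma abs_diff_less_1_iff:
  fixes p q :: real
  shows "\<bar>p - q\<bar> < 1 \<longleftrightarrow> \<lfloor>p\<rfloor> = \<lfloor>q\<rfloor> \<or> \<lfloor>p\<rfloor> = \<lfloor>q\<rfloor> + 1 \<and> frac p < frac q \<or>
    \<lfloor>q\<rfloor> = \<lfloor>p\<rfloor> + 1 \<and> frac q < frac p"
proof -
  have "p = of_int \<lfloor>p\<rfloor> + frac p" "q = of_int \<lfloor>q\<rfloor> + frac q" by (simp_all add: frac_def)
  moreover have "0 \<le> frac p" "frac p < 1" "0 \<le> frac q" "frac q < 1" by (simp_all add: frac_lt_1)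
  moreover consider "\<lfloor>p\<rfloor> = \<lfloor>q\<rfloor>" | "\<lfloor>p\<rfloor> = \<lfloor>q\<rfloor> + 1" | "\<lfloor>q\<rfloor> = \<lfloor>p\<rfloor> + 1"
    | "\<lfloor>p\<rfloor> \<ge> \<lfloor>q\<rfloor> + 2" | "\<lfloor>q\<rfloor> \<ge> \<lfloor>p\<rfloor> + 2" by linarith
  ultimately show ?thesis by cases (simp_all, linarith+)
qed

lemma floor_0_iff: "\<lfloor>p\<rfloor> = 0 \<longleftrightarrow> 0 \<le> p \<and> p < 1" for p :: real
  by (simp add: floor_eq_iff)

text \<open>Since both limits are \<open>a\<close>, the differences tend to 0, and the strict bound
  survives the passage to the supremum: a tail stays below \<open>r / 2\<close>, and only finitely
  many terms remain.\<close>

lemma norm_less_iff_c_seq: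
  assumes "x \<in> c_seq a" and "y \<in> c_seq a" and "0 < r"
  shows "norm (x - y) < r \<longleftrightarrow> (\<forall>n. \<bar>x n - y n\<bar> < r)"
proof
  assume "norm (x - y) < r"
  then show "\<forall>n. \<bar>x n - y n\<bar> < r"
    using norm_bounded[of "x - y"] by (auto intro: le_less_trans)
next
  assume *: "\<forall>n. \<bar>x n - y n\<bar> < r"
  have "(\<lambda>n. x n - y n) \<longlonglongrightarrow> a - a"
    using assms by (intro tendsto_diff) (auto simp: c_seq_def)
  then have "eventually (\<lambda>n. \<bar>x n - y n\<bar> < r / 2) sequentially"
    using \<open>0 < r\<close> by (auto dest: tendstoD[where e = "r / 2"] simp: dist_real_def)
  then obtain N where N: "\<And>n. n \<ge> N \<Longrightarrow> \<bar>x n - y n\<bar> < r / 2"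
    by (auto simp: eventually_sequentially)
  \<comment> \<open>The entry \<open>r / 2\<close> bounds the tail and keeps the set nonempty when
    \<open>N = 0\<close>.\<close>
  define b where "b = Max (insert (r / 2) ((\<lambda>n. \<bar>x n - y n\<bar>) ` {..<N}))"
  have "b < r"
    unfolding b_def using * \<open>0 < r\<close> by (subst Max_less_iff) auto
  have "\<bar>x n - y n\<bar> \<le> b" for n
  proof (cases "n < N")
    case True
    then show ?thesis unfolding b_def by (intro Max_ge) auto
  next
    case False
    then have "\<bar>x n - y n\<bar> \<le> r / 2" using N[of n] by simp
    also have "\<dots> \<le> b" unfolding b_def by (intro Max_ge) auto
    finally show ?thesis .
  qed
  then have "norm (x - y) \<le> b"
    by (intro norm_bound) simp
  then show "norm (x - y) < r" using \<open>b < r\<close> by simp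
qed

lemma finite_floor_nonzero_c_seq:
  assumes "x \<in> c_seq a" and "0 < a" and "a < 1"
  shows "finite {n. \<lfloor>x n\<rfloor> \<noteq> 0}"
proof -
  have "eventually (\<lambda>n. x n > 0 \<and> x n < 1) sequentially"
    using assms by (intro eventually_conj) (auto simp: c_seq_def order_tendsto_iff)
  then have "eventually (\<lambda>n. \<lfloor>x n\<rfloor> = 0) sequentially"
    by eventually_elim (simp add: floor_0_iff)
  then show ?thesis
    by (simp add: cofinite_eq_sequentially[symmetric] eventually_cofinite)
qed

text \<open>Supplies the centre of the neighbourhood of admissible images: prescribed values at the
  matched coordinates and the limit \<open>a\<close> elsewhere.\<close>

lemma c_seq_override:
  assumes "finite S"
  obtains x where "x \<in> c_seq a" and "\<And>n. n \<in> S \<Longrightarrow> apply_bcontfun x n = c n"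
    and "\<And>n. n \<notin> S \<Longrightarrow> apply_bcontfun x n = a"
proof -
  define f where "f = (\<lambda>n. if n \<in> S then c n else a)"
  have "eventually (\<lambda>n. f n = a) sequentially"
    using assms by (auto simp: cofinite_eq_sequentially[symmetric] eventually_cofinite f_def)
  then have f: "f \<longlonglongrightarrow> a"
    by (rule tendsto_eventually)
  then have "f \<in> bcontfun"
    using convergent_imp_bounded[OF f] by (simp add: bcontfun_def continuous_on_discrete)
  then have [simp]: "apply_bcontfun (Bcontfun f) = f"
    by (rule Bcontfun_inverse)
  show ?thesis
    by (rule that[of "Bcontfun f"]) (simp_all add: c_seq_def f, simp_all add: f_def)
qed

text \<open>Ensures that fractional parts at a fixed position order the vertices strictly and
  linearly, as \<open>iop\<close> demands.\<close>

lemma inj_on_frac_idf: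
  assumes "idf A"
  shows "inj_on (\<lambda>x. frac (apply_bcontfun x n)) A"
proof (rule inj_onI)
  fix x y assume xy: "x \<in> A" "y \<in> A" "frac (x n) = frac (y n)"
  then have "x n - y n = of_int (\<lfloor>x n\<rfloor> - \<lfloor>y n\<rfloor>)"
    by (simp add: frac_def)
  then have "x n - y n \<in> \<int>" by (metis Ints_of_int)
  with xy(1,2) show "x = y" using assms by (auto simp: idf_def)
qed

lemma gecD:
  assumes "gec G" and "0 < \<delta>" and "\<delta> < 1" and "x \<in> pverts G"
    and "finite A \<and> finite B \<and> A \<subseteq> pverts G \<and> B \<subseteq> pverts G \<and> A \<inter> B = {} \<and> A \<union> B \<subseteq> ball x 1"
  shows "\<exists>z\<in>pverts G - (A \<union> B \<union> {x}). (\<forall>u\<in>A. (z, u) \<in> parcs G) \<and>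
    (\<forall>u\<in>B. (z, u) \<notin> parcs G) \<and> A \<union> B \<subseteq> ball z 1 \<and> norm (x - z) < \<delta>"
  by (rule assms(1)[unfolded gec_def, rule_format]) (use assms in simp_all)

text \<open>
  Asking for each ordering \<open>card E + 1\<close> times yields a position outside of \<open>E\<close>.
\<close>

lemma iop_positions:
  fixes x :: "'i \<Rightarrow> (nat \<Rightarrow>\<^sub>C real)" and g :: "'f \<Rightarrow> 'i \<Rightarrow> real" and E :: "nat set"
  assumes "iop A" and "finite I" and x: "x ` I \<subseteq> A" "inj_on x I"
    and "finite F" and "finite E" and g: "\<And>n. n \<in> F \<Longrightarrow> inj_on (g n) I"
  obtains j where "inj_on j F" and "j ` F \<inter> E = {}"
    and "\<And>n p q. n \<in> F \<Longrightarrow> p \<in> I \<Longrightarrow> q \<in> I \<Longrightarrow>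
      g n p < g n q \<longleftrightarrow> frac (x p (j n)) < frac (x q (j n))"
proof -
  define k where "k = card I"
  define X where "X = F \<times> {..card E}"
  define N where "N = card X"
  have "finite X" using \<open>finite F\<close> by (simp add: X_def)
  obtain e where e: "bij_betw e {1..k} I"
    using ex_bij_betw_nat_finite_1[OF \<open>finite I\<close>] by (auto simp: k_def)
  obtain b where b: "bij_betw b {1..N} X"
    using ex_bij_betw_nat_finite_1[OF \<open>finite X\<close>] by (auto simp: N_def)
  define b' where "b' = inv_into {1..N} b"
  have b': "bij_betw b' X {1..N}"
    unfolding b'_def using b by (rule bij_betw_inv_into)
  have bb': "b (b' p) = p" if "p \<in> X" for p
    using b that by (simp add: b'_def bij_betw_inv_into_right)
  have e_inj: "inj_on e {1..k}" and e_img: "e ` {1..k} = I"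
    using e by (auto simp: bij_betw_def)
  \<comment> \<open>The ordering numbered \<open>l\<close> depends only on the first component of
    \<open>b l\<close>, so all copies \<open>(n, i)\<close> of \<open>n\<close> ask for the same
    ordering.\<close>
  define R where "R = (\<lambda>l. {(m, n). m \<in> {1..k} \<and> n \<in> {1..k} \<and>
    g (fst (b l)) (e m) < g (fst (b l)) (e n)})"
  have R: "R l \<subseteq> {1..k} \<times> {1..k} \<and> strict_linear_order_on {1..k} (R l)" if "l \<in> {1..N}" for l
  proof -
    have "b l \<in> X" using b that by (auto simp: bij_betw_def)
    then have "inj_on (g (fst (b l))) I" using g by (auto simp: X_def)
    then have "inj_on (g (fst (b l)) \<circ> e) {1..k}"
      using e_inj e_img by (intro comp_inj_on) auto
    then have "g (fst (b l)) (e m) \<noteq> g (fst (b l)) (e n)" if "m \<in> {1..k}" "n \<in> {1..k}" "m \<noteq> n" for m n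
      using inj_on_eq_iff[OF _ that(1,2)] that(3) by fastforce
    then show ?thesis
      unfolding strict_linear_order_on_def total_on_def irrefl_def trans_def R_def
      by (auto simp: neq_iff)
  qed
  have "(x \<circ> e) ` {1..k} \<subseteq> A \<and> inj_on (x \<circ> e) {1..k} \<and>
       (\<forall>l\<in>{1..N}. R l \<subseteq> {1..k} \<times> {1..k} \<and> strict_linear_order_on {1..k} (R l))"
    using R x comp_inj_on[OF e_inj, of x] by (simp only: e_img image_comp[symmetric]) blast
  from \<open>iop A\<close>[unfolded iop_def, THEN spec, THEN spec, THEN spec, THEN spec, THEN mp, OF this]
  obtain j0 :: "nat \<Rightarrow> nat" where j0: "inj_on j0 {1..N}"
    and j0_R: "\<forall>l\<in>{1..N}. \<forall>m\<in>{1..k}. \<forall>n\<in>{1..k}.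
      (m, n) \<in> R l \<longleftrightarrow> frac ((x \<circ> e) m (j0 l)) < frac ((x \<circ> e) n (j0 l))"
    by (elim exE conjE)
  define h where "h = j0 \<circ> b'"
  have h: "inj_on h X"
    unfolding h_def using b' j0 by (auto simp: bij_betw_def intro!: comp_inj_on)
  \<comment> \<open>Pigeonhole: the \<open>card E + 1\<close> copies of \<open>n\<close> receive
    distinct positions, which cannot all lie in \<open>E\<close>.\<close>
  have "\<exists>i\<in>{..card E}. h (n, i) \<notin> E" if "n \<in> F" for n
  proof (rule ccontr)
    assume "\<not> ?thesis"
    then have "(\<lambda>i. h (n, i)) ` {..card E} \<subseteq> E" by auto
    moreover have "inj_on (\<lambda>i. h (n, i)) {..card E}"
      using h that by (auto simp: inj_on_def X_def)
    ultimately have "card {..card E} \<le> card E"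
      using \<open>finite E\<close> by (metis card_image card_mono)
    then show False by simp
  qed
  then obtain i where i: "\<And>n. n \<in> F \<Longrightarrow> i n \<in> {..card E}" "\<And>n. n \<in> F \<Longrightarrow> h (n, i n) \<notin> E"
    by metis
  show ?thesis
  proof (rule that)
    show "inj_on (\<lambda>n. h (n, i n)) F"
    proof (rule inj_onI)
      fix m n assume "m \<in> F" "n \<in> F" "h (m, i m) = h (n, i n)"
      then show "m = n"
        using inj_onD[OF h, of "(m, i m)" "(n, i n)"] i(1) by (simp add: X_def)
    qed
    show "(\<lambda>n. h (n, i n)) ` F \<inter> E = {}"
      using i(2) by auto
    fix n p q assume n: "n \<in> F" and p: "p \<in> I" and q: "q \<in> I"
    have nX: "(n, i n) \<in> X" using n i by (simp add: X_def)
    then have l: "b' (n, i n) \<in> {1..N}" using b' by (auto simp: bij_betw_def)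
    obtain p' q' where pq: "p = e p'" "q = e q'" "p' \<in> {1..k}" "q' \<in> {1..k}"
      using p q e_img by blast
    then show "g n p < g n q \<longleftrightarrow> frac (x p (h (n, i n))) < frac (x q (h (n, i n)))"
      using j0_R[rule_format, OF l pq(3,4)] bb'[OF nX] by (simp add: R_def h_def)
  qed
qed

section \<open>Partial isomorphisms and matchings of coordinates\<close>

text \<open>By \<open>abs_diff_less_1_iff\<close>, these data determine which coordinate differences
  are below 1, so corresponding differences at \<open>n\<close> and at \<open>m\<close> are below 1
  together.\<close>

definition same_position :: "((nat \<Rightarrow>\<^sub>C real) \<times> (nat \<Rightarrow>\<^sub>C real)) set \<Rightarrow> nat \<Rightarrow> nat \<Rightarrow> bool" where
  "same_position \<Phi> n m \<longleftrightarrow>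
    (\<forall>(s, t)\<in>\<Phi>. \<lfloor>apply_bcontfun s n\<rfloor> = \<lfloor>apply_bcontfun t m\<rfloor>) \<and>
    (\<forall>(s, t)\<in>\<Phi>. \<forall>(s', t')\<in>\<Phi>.
      frac (apply_bcontfun s n) < frac (apply_bcontfun s' n) \<longleftrightarrow>
      frac (apply_bcontfun t m) < frac (apply_bcontfun t' m))"

text \<open>\<open>P\<close> is the graph of a finite partial injection, kept as a relation so that
  the two sides are interchanged by taking converses. At an unmatched coordinate all values lie in
  [0, 1), so no difference there reaches 1.\<close>

definition position_matching ::
    "((nat \<Rightarrow>\<^sub>C real) \<times> (nat \<Rightarrow>\<^sub>C real)) set \<Rightarrow> nat rel \<Rightarrow> bool" where
  "position_matching \<Phi> P \<longleftrightarrow>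
    finite P \<and> (\<forall>(n, m)\<in>P. \<forall>(n', m')\<in>P. n = n' \<longleftrightarrow> m = m') \<and>
    (\<forall>(n, m)\<in>P. same_position \<Phi> n m) \<and>
    (\<forall>(s, t)\<in>\<Phi>. (\<forall>n. n \<notin> Domain P \<longrightarrow> \<lfloor>apply_bcontfun s n\<rfloor> = 0) \<and>
      (\<forall>m. m \<notin> Range P \<longrightarrow> \<lfloor>apply_bcontfun t m\<rfloor> = 0))"

text \<open>The matching is bound existentially: it may change from one extension to the next, while
  only \<Phi> has to grow along the chain.\<close>

definition partial_iso ::
    "(nat \<Rightarrow>\<^sub>C real) pair_pre_digraph \<Rightarrow> (nat \<Rightarrow>\<^sub>C real) pair_pre_digraph \<Rightarrow>
      ((nat \<Rightarrow>\<^sub>C real) \<times> (nat \<Rightarrow>\<^sub>C real)) set \<Rightarrow> bool" where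
  "partial_iso G H \<Phi> \<longleftrightarrow>
    finite \<Phi> \<and> \<Phi> \<subseteq> pverts G \<times> pverts H \<and>
    (\<forall>(s, t)\<in>\<Phi>. \<forall>(s', t')\<in>\<Phi>. (s = s' \<longleftrightarrow> t = t') \<and> ((s, s') \<in> parcs G \<longleftrightarrow> (t, t') \<in> parcs H)) \<and>
    (\<exists>P. position_matching \<Phi> P)"

lemma same_position_converse:
  "same_position \<Phi> n m \<Longrightarrow> same_position (\<Phi>\<inverse>) m n"
  by (auto simp: same_position_def)

lemma partial_isoD:
  assumes "partial_iso G H \<Phi>" and "(s, t) \<in> \<Phi>" and "(s', t') \<in> \<Phi>"
  shows "s = s' \<longleftrightarrow> t = t'" and "(s, s') \<in> parcs G \<longleftrightarrow> (t, t') \<in> parcs H"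
proof -
  have "\<forall>(s, t)\<in>\<Phi>. \<forall>(s', t')\<in>\<Phi>. (s = s' \<longleftrightarrow> t = t') \<and> ((s, s') \<in> parcs G \<longleftrightarrow> (t, t') \<in> parcs H)"
    using assms(1) by (simp add: partial_iso_def)
  from bspec[OF this assms(2), unfolded prod.case, THEN bspec, OF assms(3), unfolded prod.case]
  show "s = s' \<longleftrightarrow> t = t'" and "(s, s') \<in> parcs G \<longleftrightarrow> (t, t') \<in> parcs H" by simp_all
qed

lemma position_matching_empty: "position_matching {} {}"
  by (simp add: position_matching_def)

lemma position_matching_converse:
  assumes "position_matching \<Phi> P"
  shows "position_matching (\<Phi>\<inverse>) (P\<inverse>)"
proof -
  have "finite (P\<inverse>)" "\<forall>(n, m)\<in>P\<inverse>. \<forall>(n', m')\<in>P\<inverse>. n = n' \<longleftrightarrow> m = m'"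
    "\<forall>(n, m)\<in>P\<inverse>. same_position (\<Phi>\<inverse>) n m"
    using assms by (auto simp: position_matching_def intro: same_position_converse)
  then show ?thesis
    using assms by (auto simp: position_matching_def)
qed

text \<open>With this symmetry, extending domains also yields the extension of ranges.\<close>

lemma partial_iso_converse:
  assumes "partial_iso G H \<Phi>"
  shows "partial_iso H G (\<Phi>\<inverse>)"
proof -
  obtain P where "position_matching \<Phi> P" using assms by (auto simp: partial_iso_def)
  then have "\<exists>P. position_matching (\<Phi>\<inverse>) P" using position_matching_converse by blast
  moreover have "\<forall>(s, t)\<in>\<Phi>\<inverse>. \<forall>(s', t')\<in>\<Phi>\<inverse>. (s = s' \<longleftrightarrow> t = t') \<and>
      ((s, s') \<in> parcs H \<longleftrightarrow> (t, t') \<in> parcs G)"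
    using assms by (auto simp: partial_iso_def)
  ultimately show ?thesis using assms by (auto simp: partial_iso_def)
qed

lemma same_position_subset:
  assumes "same_position \<Phi> n m" and "\<Psi> \<subseteq> \<Phi>"
  shows "same_position \<Psi> n m"
  using assms by (auto simp: same_position_def case_prod_beta)

lemma position_matching_subset:
  assumes "position_matching \<Phi> P" and "\<Psi> \<subseteq> \<Phi>"
  shows "position_matching \<Psi> P"
proof -
  have "\<forall>(n, m)\<in>P. same_position \<Psi> n m"
    using assms same_position_subset by (auto simp: position_matching_def)
  then show ?thesis
    using assms(1) unfolding position_matching_def by (meson assms(2) subsetD)
qed

text \<open>Each coordinate \<open>m\<close> is treated separately: if matched, it inherits the
  bound from its partner; if not, both floors vanish. Attainment of the supremum turns this into a
  bound on the norm.\<close>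

lemma norm_less_1_position_matching:
  assumes "position_matching {(s, t), (v, w)} P"
    and "s \<in> c_seq a" and "v \<in> c_seq a" and "t \<in> c_seq b" and "w \<in> c_seq b"
    and "norm (s - v) < 1"
  shows "norm (t - w) < 1"
proof -
  have "\<bar>t m - w m\<bar> < 1" for m
  proof (cases "m \<in> Range P")
    case True
    then obtain n where "(n, m) \<in> P" by blast
    then have "same_position {(s, t), (v, w)} n m"
      using assms(1) by (auto simp: position_matching_def)
    moreover have "\<bar>s n - v n\<bar> < 1"
      using assms norm_less_iff_c_seq[of s a v 1] by simp
    ultimately show ?thesis
      by (auto simp: same_position_def abs_diff_less_1_iff)
  next
    case False
    then show ?thesis
      using assms(1) by (auto simp: position_matching_def abs_diff_less_1_iff)
  qed
  then show ?thesis
    using assms norm_less_iff_c_seq[of t b w 1] by simp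
qed

lemma norm_less_1_position_matching_iff:
  assumes "position_matching {(s, t), (v, w)} P"
    and "s \<in> c_seq a" and "v \<in> c_seq a" and "t \<in> c_seq b" and "w \<in> c_seq b"
  shows "norm (s - v) < 1 \<longleftrightarrow> norm (t - w) < 1"
proof -
  have "{(s, t), (v, w)}\<inverse> = {(t, s), (w, v)}" by auto
  then have "position_matching {(t, s), (w, v)} (P\<inverse>)"
    using position_matching_converse[OF assms(1)] by simp
  then show ?thesis
    using norm_less_1_position_matching assms by blast
qed

text \<open>Evaluation is continuous for the supremum norm, so finitely many strict inequalities
  between coordinates and constants define an open set.\<close>

lemma tendsto_apply_bcontfun_nhds:
  "((\<lambda>w. apply_bcontfun w x) \<longlongrightarrow> apply_bcontfun w0 x) (nhds w0)"
proof (rule tendstoI)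
  fix e :: real assume "e > 0"
  then show "\<forall>\<^sub>F w in nhds w0. dist (apply_bcontfun w x) (apply_bcontfun w0 x) < e"
    unfolding eventually_nhds_metric using dist_bounded le_less_trans by blast
qed

section \<open>Extension by one vertex\<close>

text \<open>Only the matching grows here. At a coordinate outside it all floors of members of \<Phi>
  are already 0, so a fresh partner has to reproduce nothing but the order of the fractional parts,
  which the i.o.p. achieves.\<close>

lemma position_matching_extend_coordinates:
  assumes pm: "position_matching \<Phi> P" and "finite \<Phi>" and \<Phi>: "\<Phi> \<subseteq> V \<times> W"
    and inj: "inj_on fst \<Phi>" "inj_on snd \<Phi>"
    and "idf V" and "iop W" and v: "v \<in> c_seq a" "0 < a" "a < 1"
  obtains P' where "position_matching \<Phi> P'" and "\<And>n. n \<notin> Domain P' \<Longrightarrow> \<lfloor>apply_bcontfun v n\<rfloor> = 0"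
proof -
  define F where "F = {n. \<lfloor>v n\<rfloor> \<noteq> 0} - Domain P"
  have "finite P" using pm by (simp add: position_matching_def)
  have "finite F" using finite_floor_nonzero_c_seq[OF v] by (simp add: F_def)
  have g: "inj_on (\<lambda>p. frac (apply_bcontfun (fst p) n)) \<Phi>" for n
  proof -
    have "fst ` \<Phi> \<subseteq> V" using \<Phi> by auto
    then have "inj_on (\<lambda>s. frac (apply_bcontfun s n)) (fst ` \<Phi>)"
      using inj_on_frac_idf[OF \<open>idf V\<close>] inj_on_subset by blast
    from comp_inj_on[OF inj(1) this] show ?thesis by (simp add: comp_def)
  qed
  have "snd ` \<Phi> \<subseteq> W" using \<Phi> by auto
  obtain j where j: "inj_on j F" "j ` F \<inter> Range P = {}"
    and j_less: "\<And>n p q. n \<in> F \<Longrightarrow> p \<in> \<Phi> \<Longrightarrow> q \<in> \<Phi> \<Longrightarrow>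
      frac (apply_bcontfun (fst p) n) < frac (apply_bcontfun (fst q) n) \<longleftrightarrow>
      frac (apply_bcontfun (snd p) (j n)) < frac (apply_bcontfun (snd q) (j n))"
    \<comment> \<open>The index set is \<Phi> itself: the first component of a pair dictates the
      ordering and the second is the vertex realising it. Avoiding \<open>Range P\<close> makes the
      partners fresh.\<close>
    by (rule iop_positions[where g = "\<lambda>n p. frac (apply_bcontfun (fst p) n)", OF \<open>iop W\<close> \<open>finite \<Phi>\<close>
          \<open>snd ` \<Phi> \<subseteq> W\<close> inj(2) \<open>finite F\<close> finite_Range[OF \<open>finite P\<close>] g]) blast
  define P' where "P' = P \<union> (\<lambda>n. (n, j n)) ` F"
  have Dom: "Domain P' = Domain P \<union> F" and Ran: "Range P' = Range P \<union> j ` F"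
    by (auto simp: P'_def)
  have floor_fst: "\<lfloor>apply_bcontfun s n\<rfloor> = 0" if "(s, t) \<in> \<Phi>" "n \<notin> Domain P" for s t n
    using pm that by (fastforce simp: position_matching_def)
  have floor_snd: "\<lfloor>apply_bcontfun t m\<rfloor> = 0" if "(s, t) \<in> \<Phi>" "m \<notin> Range P" for s t m
    using pm that by (fastforce simp: position_matching_def)
  have "same_position \<Phi> n (j n)" if "n \<in> F" for n
  proof -
    have "n \<notin> Domain P" "j n \<notin> Range P"
      using that j(2) by (auto simp: F_def)
    then show ?thesis
      using j_less[OF that] floor_fst floor_snd by (auto simp: same_position_def)
  qed
  then have same: "\<forall>(n, m)\<in>P'. same_position \<Phi> n m"
    using pm by (auto simp: position_matching_def P'_def)
  have 1: "n = n' \<longleftrightarrow> m = m'" if "(n, m) \<in> P" "(n', m') \<in> P" for n m n' m'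
    using pm that by (fastforce simp: position_matching_def)
  have 2: "n \<noteq> n' \<and> m \<noteq> j n'" if "(n, m) \<in> P" "n' \<in> F" for n m n'
    using that j(2) by (auto simp: F_def)
  have "\<forall>(n, m)\<in>P'. \<forall>(n', m')\<in>P'. n = n' \<longleftrightarrow> m = m'"
    using 1 inj_on_eq_iff[OF j(1)] by (auto simp: P'_def dest: 2)
  moreover have "\<forall>(s, t)\<in>\<Phi>. (\<forall>n. n \<notin> Domain P' \<longrightarrow> \<lfloor>apply_bcontfun s n\<rfloor> = 0) \<and>
      (\<forall>m. m \<notin> Range P' \<longrightarrow> \<lfloor>apply_bcontfun t m\<rfloor> = 0)"
    using floor_fst floor_snd by (auto simp: Dom Ran)
  moreover have "finite P'" using \<open>finite P\<close> \<open>finite F\<close> by (simp add: P'_def)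
  ultimately have "position_matching \<Phi> P'"
    using same unfolding position_matching_def by blast
  moreover have "\<lfloor>v n\<rfloor> = 0" if "n \<notin> Domain P'" for n
    using that by (auto simp: Dom F_def)
  ultimately show ?thesis by (rule that)
qed

text \<open>At each matched coordinate the image must have the floor of \<open>v\<close> and a
  fractional part in the gap that corresponds to the place of \<open>v\<close> among the first
  components. Such gaps are nonempty open intervals, and there are finitely many of them.\<close>

lemma position_matching_neighbourhood:
  assumes pm: "position_matching \<Phi> P" and "finite \<Phi>" and \<Phi>: "\<Phi> \<subseteq> V \<times> W"
    and "idf V" and "idf W" and v: "v \<in> V" "v \<notin> Domain \<Phi>"
    and v0: "\<And>n. n \<notin> Domain P \<Longrightarrow> \<lfloor>apply_bcontfun v n\<rfloor> = 0"
    and a: "0 < a" "a < 1"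
  obtains w0 where "w0 \<in> c_seq a"
    and "\<forall>\<^sub>F w in nhds w0. position_matching (insert (v, w) \<Phi>) P"
proof -
  \<comment> \<open>\<open>Q n m y\<close> says that \<open>y\<close> is an admissible value at
    \<open>m\<close> when \<open>m\<close> is the partner of \<open>n\<close>.\<close>
  define Q where "Q = (\<lambda>n m y. real_of_int \<lfloor>v n\<rfloor> < y \<and> y < real_of_int \<lfloor>v n\<rfloor> + 1 \<and>
    (\<forall>p\<in>\<Phi>. frac (apply_bcontfun (fst p) n) < frac (apply_bcontfun v n) \<longrightarrow> real_of_int \<lfloor>v n\<rfloor> + frac (apply_bcontfun (snd p) m) < y) \<and>
    (\<forall>p\<in>\<Phi>. frac (apply_bcontfun v n) < frac (apply_bcontfun (fst p) n) \<longrightarrow> y < real_of_int \<lfloor>v n\<rfloor> + frac (apply_bcontfun (snd p) m)))"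
  have "finite P" using pm by (simp add: position_matching_def)
  have P_inj: "n = n' \<longleftrightarrow> m = m'" if "(n, m) \<in> P" "(n', m') \<in> P" for n m n' m'
    using pm that by (fastforce simp: position_matching_def)
  have P_same: "same_position \<Phi> n m" if "(n, m) \<in> P" for n m
    using pm that by (fastforce simp: position_matching_def)
  have gap: "\<exists>y. Q n m y" if "(n, m) \<in> P" for n m
  proof -
    define k where "k = real_of_int \<lfloor>v n\<rfloor>"
    define L where "L = insert k ((\<lambda>p. k + frac (apply_bcontfun (snd p) m)) ` {p\<in>\<Phi>. frac (apply_bcontfun (fst p) n) < frac (apply_bcontfun v n)})"
    define U where "U = insert (k + 1) ((\<lambda>p. k + frac (apply_bcontfun (snd p) m)) ` {p\<in>\<Phi>. frac (apply_bcontfun v n) < frac (apply_bcontfun (fst p) n)})"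
    have L: "finite L" "L \<noteq> {}" and U: "finite U" "U \<noteq> {}"
      using \<open>finite \<Phi>\<close> by (auto simp: L_def U_def)
    \<comment> \<open>Members of an i.d.f. set have no integer coordinate, so the lower end
      \<open>k\<close> stays strictly below every element of \<open>U\<close>.\<close>
    have pos: "0 < frac (apply_bcontfun (snd p) m)" if "p \<in> \<Phi>" for p
      using that \<Phi> \<open>idf W\<close> by (auto simp: idf_def)
    have ord: "frac (apply_bcontfun (snd p) m) < frac (apply_bcontfun (snd q) m)"
      if "p \<in> \<Phi>" "q \<in> \<Phi>" "frac (apply_bcontfun (fst p) n) < frac (apply_bcontfun v n)" "frac (apply_bcontfun v n) < frac (apply_bcontfun (fst q) n)" for p q
    proof -
      have "frac (apply_bcontfun (fst p) n) < frac (apply_bcontfun (fst q) n)" using that by linarith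
      then show ?thesis
        using P_same[OF \<open>(n, m) \<in> P\<close>] that(1,2) by (auto simp: same_position_def case_prod_beta)
    qed
    have "\<forall>l\<in>L. \<forall>u\<in>U. l < u"
      using pos ord by (auto simp: L_def U_def frac_lt_1)
    then have "Max L < Min U"
      using L U by simp
    then obtain y where "Max L < y" "y < Min U" using dense by blast
    then have "\<forall>l\<in>L. l < y" "\<forall>u\<in>U. y < u" using L U by auto
    then have "Q n m y" by (auto simp: Q_def L_def U_def k_def)
    then show ?thesis ..
  qed
  \<comment> \<open>A matched \<open>m\<close> has only one partner \<open>n\<close>, so the value
    can be chosen as a function of \<open>m\<close> alone.\<close>
  have "\<forall>m\<in>Range P. \<exists>y. \<forall>n. (n, m) \<in> P \<longrightarrow> Q n m y"
    using gap P_inj by (metis RangeE)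
  then obtain c where c: "\<And>n m. (n, m) \<in> P \<Longrightarrow> Q n m (c m)"
    by (metis RangeI)
  obtain w0 where w0: "w0 \<in> c_seq a" "\<And>m. m \<in> Range P \<Longrightarrow> apply_bcontfun w0 m = c m"
      "\<And>m. m \<notin> Range P \<Longrightarrow> apply_bcontfun w0 m = a"
    using c_seq_override[OF finite_Range[OF \<open>finite P\<close>]] by metis
  have "\<forall>\<^sub>F w in nhds w0. Q n m (apply_bcontfun w m)" if "(n, m) \<in> P" for n m
  proof -
    note tendsto = order_tendstoD[OF tendsto_apply_bcontfun_nhds[of m w0]]
    have "Q n m (apply_bcontfun w0 m)" using c[OF that] w0(2)[OF RangeI[OF that]] by simp
    moreover have "\<forall>\<^sub>F w in nhds w0. R \<longrightarrow> S w" if "R \<Longrightarrow> eventually S (nhds w0)" for R S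
      using that by (cases R) auto
    ultimately show ?thesis
      unfolding Q_def using \<open>finite \<Phi>\<close>
      by (intro eventually_conj eventually_ball_finite ballI) (auto intro: tendsto)
  qed
  then have "\<forall>\<^sub>F w in nhds w0. \<forall>p\<in>P. Q (fst p) (snd p) (apply_bcontfun w (snd p))"
    using \<open>finite P\<close> by (intro eventually_ball_finite) auto
  \<comment> \<open>Off \<open>Range P\<close> the value of \<open>w0\<close> is \<open>a\<close>;
    this radius keeps nearby values in (0, 1), where the floor is 0.\<close>
  moreover have "\<forall>\<^sub>F w in nhds w0. dist w w0 < min a (1 - a)"
    unfolding eventually_nhds_metric using a by (intro exI[of _ "min a (1 - a)"]) auto
  ultimately have "\<forall>\<^sub>F w in nhds w0. position_matching (insert (v, w) \<Phi>) P"
  proof eventually_elim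
    case (elim w)
    have w_floor: "\<lfloor>w m\<rfloor> = 0" if "m \<notin> Range P" for m
    proof -
      have "\<bar>w m - a\<bar> < min a (1 - a)"
        using dist_bounded[of w m w0] elim(2) w0(3)[OF that] by (simp add: dist_real_def)
      then have "0 < w m" "w m < 1" by linarith+
      then show ?thesis by (simp add: floor_0_iff)
    qed
    have "same_position (insert (v, w) \<Phi>) n m" if nm: "(n, m) \<in> P" for n m
    proof -
      have Q: "Q n m (w m)" using elim(1) nm by force
      then have fl: "\<lfloor>w m\<rfloor> = \<lfloor>v n\<rfloor>" by (auto simp: Q_def intro!: floor_unique)
      then have fr: "frac (apply_bcontfun w m) = w m - real_of_int \<lfloor>v n\<rfloor>" by (simp add: frac_def)
      have "(frac (apply_bcontfun s n) < frac (apply_bcontfun v n) \<longleftrightarrow> frac (apply_bcontfun t m) < frac (apply_bcontfun w m)) \<and>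
          (frac (apply_bcontfun v n) < frac (apply_bcontfun s n) \<longleftrightarrow> frac (apply_bcontfun w m) < frac (apply_bcontfun t m))" if st: "(s, t) \<in> \<Phi>" for s t
      proof -
        \<comment> \<open>\<open>Q\<close> provides implications only; the absence of ties on the
          left turns them into equivalences.\<close>
        have "s \<in> V" "s \<noteq> v" using st \<Phi> v by auto
        then have "frac (apply_bcontfun s n) \<noteq> frac (apply_bcontfun v n)"
          using inj_onD[OF inj_on_frac_idf[OF \<open>idf V\<close>]] v(1) by blast
        moreover have "frac (apply_bcontfun s n) < frac (apply_bcontfun v n) \<longrightarrow> real_of_int \<lfloor>v n\<rfloor> + frac (apply_bcontfun t m) < w m"
          "frac (apply_bcontfun v n) < frac (apply_bcontfun s n) \<longrightarrow> w m < real_of_int \<lfloor>v n\<rfloor> + frac (apply_bcontfun t m)"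
          using Q st by (auto simp: Q_def)
        ultimately show ?thesis unfolding fr by linarith
      qed
      then show ?thesis
        using P_same[OF nm] fl by (auto simp: same_position_def)
    qed
    then show ?case
      using pm v0 w_floor by (auto simp: position_matching_def)
  qed
  with w0(1) show ?thesis by (rule that)
qed

text \<open>Density places a vertex \<open>x\<close> among the admissible images of
  \<open>v\<close>, with the right distances but perhaps the wrong adjacencies. The g.e.c. property
  replaces it by a nearby vertex \<open>z\<close>, still admissible, with the right
  adjacencies.\<close>

lemma partial_iso_extend:
  assumes a: "0 < a" "a < 1"
    and V: "pverts G \<subseteq> c_seq a" "idf (pverts G)"
    and W: "pverts H \<subseteq> c_seq a" "c_seq a \<subseteq> closure (pverts H)" "idf (pverts H)" "iop (pverts H)"
    and G: "geometric_1_graph G" and H: "geometric_1_graph H"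
    and iso: "partial_iso G H \<Phi>" and v: "v \<in> pverts G"
  shows "\<exists>\<Psi>. partial_iso G H \<Psi> \<and> \<Phi> \<subseteq> \<Psi> \<and> v \<in> Domain \<Psi>"
proof (cases "v \<in> Domain \<Phi>")
  case True
  with iso show ?thesis by blast
next
  case False
  have "finite \<Phi>" and \<Phi>: "\<Phi> \<subseteq> pverts G \<times> pverts H"
    using iso by (simp_all add: partial_iso_def)
  have \<Phi>_pair: "(s = s' \<longleftrightarrow> t = t') \<and> ((s, s') \<in> parcs G \<longleftrightarrow> (t, t') \<in> parcs H)"
    if "(s, t) \<in> \<Phi>" "(s', t') \<in> \<Phi>" for s t s' t'
    using partial_isoD[OF iso that] by simp
  have inj: "inj_on fst \<Phi>" "inj_on snd \<Phi>"
    using \<Phi>_pair by (auto simp: inj_on_def)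
  have v_c: "v \<in> c_seq a" using v V by blast
  obtain P0 where P0: "position_matching \<Phi> P0"
    using iso by (auto simp: partial_iso_def)
  obtain P where P: "position_matching \<Phi> P" "\<And>n. n \<notin> Domain P \<Longrightarrow> \<lfloor>apply_bcontfun v n\<rfloor> = 0"
    using position_matching_extend_coordinates[OF P0 \<open>finite \<Phi>\<close> \<Phi> inj V(2) W(4) v_c a] by blast
  obtain w0 where w0: "w0 \<in> c_seq a"
    and "\<forall>\<^sub>F w in nhds w0. position_matching (insert (v, w) \<Phi>) P"
    using position_matching_neighbourhood[OF P(1) \<open>finite \<Phi>\<close> \<Phi> V(2) W(3) v False P(2) a] .
  then obtain S where S: "open S" "w0 \<in> S"
    and S_pm: "\<And>w. w \<in> S \<Longrightarrow> position_matching (insert (v, w) \<Phi>) P"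
    unfolding eventually_nhds by blast
  have "w0 \<in> closure (pverts H)" using w0 W(2) by blast
  then obtain x where x: "x \<in> pverts H" "x \<in> S"
    using S by (metis closure_iff_nhds_not_empty Int_iff all_not_in_conv order_refl)
  obtain e where e: "e > 0" "ball x e \<subseteq> S"
    using S(1) x(2) openE by blast
  have near: "norm (v - s) < 1 \<longleftrightarrow> norm (w - t) < 1"
    if "w \<in> S" "w \<in> pverts H" "(s, t) \<in> \<Phi>" for w s t
  proof -
    have "position_matching {(v, w), (s, t)} P"
      using position_matching_subset[OF S_pm[OF that(1)], of "{(v, w), (s, t)}"] that(3) by simp
    moreover have "s \<in> c_seq a" "t \<in> c_seq a" "w \<in> c_seq a"
      using that \<Phi> V(1) W(1) by auto
    ultimately show ?thesis
      using norm_less_1_position_matching_iff v_c by blast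
  qed
  interpret G: pair_bidirected_digraph G using G by (simp add: geometric_1_graph_def)
  interpret H: pair_bidirected_digraph H using H by (simp add: geometric_1_graph_def)
  have G_less: "norm (u - w) < 1" if "(u, w) \<in> parcs G" for u w
    using G that by (auto simp: geometric_1_graph_def threshold_1_def)
  have H_less: "norm (u - w) < 1" if "(u, w) \<in> parcs H" for u w
    using H that by (auto simp: geometric_1_graph_def threshold_1_def)
  have G_sym: "(u, w) \<in> parcs G \<longleftrightarrow> (w, u) \<in> parcs G" for u w
    using G.pair_sym_arcs by (auto simp: symmetric_def dest: symD)
  have H_sym: "(u, w) \<in> parcs H \<longleftrightarrow> (w, u) \<in> parcs H" for u w
    using H.pair_sym_arcs by (auto simp: symmetric_def dest: symD)
  define A where "A = {t. \<exists>s. (s, t) \<in> \<Phi> \<and> (v, s) \<in> parcs G}"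
  \<comment> \<open>Cut down to the ball as the g.e.c. property requires; the images outside it will
    be excluded as neighbours by the threshold.\<close>
  define B where "B = {t. \<exists>s. (s, t) \<in> \<Phi> \<and> (v, s) \<notin> parcs G} \<inter> ball x 1"
  have AB: "A \<subseteq> Range \<Phi>" "B \<subseteq> Range \<Phi>" by (auto simp: A_def B_def)
  have "finite A \<and> finite B \<and> A \<subseteq> pverts H \<and> B \<subseteq> pverts H \<and> A \<inter> B = {} \<and> A \<union> B \<subseteq> ball x 1"
  proof (intro conjI)
    show "finite A" "finite B"
      using AB finite_Range[OF \<open>finite \<Phi>\<close>] finite_subset by blast+
    show "A \<subseteq> pverts H" "B \<subseteq> pverts H" using AB \<Phi> by auto
    show "A \<inter> B = {}" using \<Phi>_pair by (auto simp: A_def B_def)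
    \<comment> \<open>Neighbours of \<open>v\<close> lie within distance 1 of it by the threshold,
      and \<open>near\<close> carries this over to \<open>x\<close>.\<close>
    show "A \<union> B \<subseteq> ball x 1"
      using near[OF x(2,1)] G_less by (fastforce simp: A_def B_def dist_norm)
  qed
  moreover have "gec H" using H by (simp add: geometric_1_graph_def)
  \<comment> \<open>The bound \<open>e\<close> keeps \<open>z\<close> inside \<open>S\<close>, and
    1/2 keeps the parameter below 1.\<close>
  ultimately have "\<exists>z\<in>pverts H - (A \<union> B \<union> {x}). (\<forall>u\<in>A. (z, u) \<in> parcs H) \<and>
      (\<forall>u\<in>B. (z, u) \<notin> parcs H) \<and> A \<union> B \<subseteq> ball z 1 \<and> norm (x - z) < min e (1 / 2)"
    using x(1) e(1) by (intro gecD) simp_all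
  then obtain z where z: "z \<in> pverts H - (A \<union> B \<union> {x})"
    and zA: "\<forall>u\<in>A. (z, u) \<in> parcs H" and zB: "\<forall>u\<in>B. (z, u) \<notin> parcs H"
    and xz: "norm (x - z) < min e (1 / 2)"
    by blast
  have zH: "z \<in> pverts H" and zS: "z \<in> S"
    using z xz e(2) by (auto simp: dist_norm)
  \<comment> \<open>An old image equal to \<open>z\<close> would lie in the ball around
    \<open>x\<close>, hence in \<open>A \<union> B\<close>, which \<open>z\<close> avoids.\<close>
  have z_new: "z \<noteq> t" if "(s, t) \<in> \<Phi>" for s t
  proof
    assume "z = t"
    with xz have "t \<in> ball x 1" by (simp add: dist_norm)
    with that have "t \<in> A \<union> B" by (auto simp: A_def B_def)
    with z \<open>z = t\<close> show False by blast
  qed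
  have z_arcs: "(v, s) \<in> parcs G \<longleftrightarrow> (z, t) \<in> parcs H" if st: "(s, t) \<in> \<Phi>" for s t
  proof
    assume "(v, s) \<in> parcs G"
    then have "t \<in> A" using st by (auto simp: A_def)
    then show "(z, t) \<in> parcs H" using zA by blast
  next
    assume zt: "(z, t) \<in> parcs H"
    \<comment> \<open>Both \<open>x\<close> and \<open>z\<close> are admissible images of
      \<open>v\<close>, so closeness passes from \<open>z\<close> to \<open>x\<close> through the
      distance of \<open>v\<close> to \<open>s\<close>.\<close>
    then have "norm (x - t) < 1"
      using near[OF zS zH st] near[OF x(2,1) st] H_less by blast
    then have "t \<in> ball x 1" by (simp add: dist_norm)
    then show "(v, s) \<in> parcs G"
      using zB zt st by (auto simp: B_def)
  qed
  have "s \<noteq> v" if "(s, t) \<in> \<Phi>" for s t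
    using that False by auto
  then have new: "(v = s \<longleftrightarrow> z = t) \<and> (s = v \<longleftrightarrow> t = z) \<and> ((v, s) \<in> parcs G \<longleftrightarrow> (z, t) \<in> parcs H) \<and>
      ((s, v) \<in> parcs G \<longleftrightarrow> (t, z) \<in> parcs H)" if "(s, t) \<in> \<Phi>" for s t
    using that z_new z_arcs G_sym H_sym by metis
  have "(v, v) \<notin> parcs G" "(z, z) \<notin> parcs H"
    using G.pair_no_loops H.pair_no_loops by force+
  then have "\<forall>(s, t)\<in>insert (v, z) \<Phi>. \<forall>(s', t')\<in>insert (v, z) \<Phi>.
      (s = s' \<longleftrightarrow> t = t') \<and> ((s, s') \<in> parcs G \<longleftrightarrow> (t, t') \<in> parcs H)"
    using new \<Phi>_pair by (simp add: case_prod_beta)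
  moreover have "position_matching (insert (v, z) \<Phi>) P"
    using S_pm[OF zS] .
  ultimately have "partial_iso G H (insert (v, z) \<Phi>)"
    unfolding partial_iso_def by (intro conjI exI) (use \<open>finite \<Phi>\<close> \<Phi> v zH in simp_all)
  then show ?thesis by blast
qed

section \<open>Assembling the isomorphism\<close>

theorem theorem5p1:
  fixes a :: real
    and V W :: "(nat \<Rightarrow>\<^sub>C real) set"
    and G H :: "(nat \<Rightarrow>\<^sub>C real) pair_pre_digraph"
  assumes "0 < a" and "a < 1"
    and "V \<subseteq> c_seq a" and "c_seq a \<subseteq> closure V" and "countable V" and "idf V" and "iop V"
    and "W \<subseteq> c_seq a" and "c_seq a \<subseteq> closure W" and "countable W" and "idf W" and "iop W"
    and "geometric_1_graph G" and "pverts G = V"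
    and "geometric_1_graph H" and "pverts H = W"
  shows "digraph_iso (with_proj G) (with_proj H)"
proof -
  note V = assms(3-7)[folded \<open>pverts G = V\<close>] and W = assms(8-12)[folded \<open>pverts H = W\<close>]
  \<comment> \<open>One requirement for each vertex: those of \<open>G\<close> must enter the
    domain, those of \<open>H\<close> the range.\<close>
  define D where "D = (\<lambda>v. {\<Phi>. v \<in> Domain \<Phi>}) ` pverts G \<union>
    (\<lambda>w. {\<Phi> :: ((nat \<Rightarrow>\<^sub>C real) \<times> (nat \<Rightarrow>\<^sub>C real)) set. w \<in> Range \<Phi>}) ` pverts H"
  have "countable D" using V W by (simp add: D_def)
  have empty: "{} \<in> {\<Phi>. partial_iso G H \<Phi>}"
    using position_matching_empty by (auto simp: partial_iso_def)
  have extend: "\<exists>\<Psi>\<in>{\<Phi>. partial_iso G H \<Phi>} \<inter> d. \<Phi> \<subseteq> \<Psi>"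
    if "d \<in> D" and \<Phi>: "\<Phi> \<in> {\<Phi>. partial_iso G H \<Phi>}" for d \<Phi>
    using \<open>d \<in> D\<close> unfolding D_def
  proof (elim UnE imageE)
    fix v assume v: "v \<in> pverts G" and d: "d = {\<Phi>. v \<in> Domain \<Phi>}"
    have "partial_iso G H \<Phi>" using \<Phi> by simp
    from partial_iso_extend[OF assms(1,2) V(1,4) W(1,2,4,5) assms(13,15) this v]
    show ?thesis by (auto simp: d)
  next
    fix w assume w: "w \<in> pverts H" and d: "d = {\<Phi>. w \<in> Range \<Phi>}"
    have "partial_iso H G (\<Phi>\<inverse>)" using \<Phi> by (simp add: partial_iso_converse)
    from partial_iso_extend[OF assms(1,2) W(1,4) V(1,2,4,5) assms(15,13) this w]
    obtain \<Psi> where \<Psi>: "partial_iso H G \<Psi>" "\<Phi>\<inverse> \<subseteq> \<Psi>" "w \<in> Domain \<Psi>" by blast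
    then have "partial_iso G H (\<Psi>\<inverse>)" "\<Phi> \<subseteq> \<Psi>\<inverse>" "w \<in> Range (\<Psi>\<inverse>)"
      using partial_iso_converse by auto
    then show ?thesis by (auto simp: d)
  qed
  obtain C :: "nat \<Rightarrow> ((nat \<Rightarrow>\<^sub>C real) \<times> (nat \<Rightarrow>\<^sub>C real)) set"
    where "incseq C" and C: "range C \<subseteq> {\<Phi>. partial_iso G H \<Phi>}"
    and C_meets: "\<And>d. d \<in> D \<Longrightarrow> range C \<inter> d \<noteq> {}"
    using countable_generic_chain[OF \<open>countable D\<close> empty extend] by blast
  define U where "U = (\<Union>n. C n)"
  \<comment> \<open>Any two pairs of the union lie in a common member of the chain.\<close>
  have U: "(s = s' \<longleftrightarrow> t = t') \<and> ((s, s') \<in> parcs G \<longleftrightarrow> (t, t') \<in> parcs H)"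
    if st: "(s, t) \<in> U" "(s', t') \<in> U" for s t s' t'
  proof -
    obtain i j where ij: "(s, t) \<in> C i" "(s', t') \<in> C j" using st by (auto simp: U_def)
    have "C i \<subseteq> C (max i j)" "C j \<subseteq> C (max i j)"
      using \<open>incseq C\<close> by (simp_all add: incseq_def)
    with ij have "(s, t) \<in> C (max i j)" "(s', t') \<in> C (max i j)" by auto
    moreover have "partial_iso G H (C (max i j))" using C by auto
    ultimately show ?thesis using partial_isoD[of G H "C (max i j)" s t s' t'] by simp
  qed
  have "C n \<subseteq> pverts G \<times> pverts H" for n
  proof -
    have "partial_iso G H (C n)" using C by auto
    then show ?thesis by (simp add: partial_iso_def)
  qed
  then have U_sub: "U \<subseteq> pverts G \<times> pverts H"
    unfolding U_def by blast
  have "\<exists>w. (v, w) \<in> U" if "v \<in> pverts G" for v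
    using C_meets[of "{\<Phi>. v \<in> Domain \<Phi>}"] that by (auto simp: D_def U_def)
  then obtain f where f: "\<And>v. v \<in> pverts G \<Longrightarrow> (v, f v) \<in> U"
    by metis
  have Ran: "w \<in> Range U" if "w \<in> pverts H" for w
    using C_meets[of "{\<Phi>. w \<in> Range \<Phi>}"] that by (auto simp: D_def U_def)
  have "bij_betw f (pverts G) (pverts H)"
    unfolding bij_betw_def
  proof (intro conjI equalityI subsetI)
    show "inj_on f (pverts G)"
      using f U by (metis inj_onI)
    show "w \<in> pverts H" if "w \<in> f ` pverts G" for w
      using that f U_sub by blast
    show "w \<in> f ` pverts G" if w: "w \<in> pverts H" for w
    proof -
      obtain v where v: "(v, w) \<in> U" using Ran[OF w] by blast
      then have "v \<in> pverts G" using U_sub by blast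
      then have "w = f v" using U[OF v f[of v]] by simp
      with \<open>v \<in> pverts G\<close> show ?thesis by blast
    qed
  qed
  moreover have "(u, v) \<in> parcs G \<longleftrightarrow> (f u, f v) \<in> parcs H"
    if "u \<in> pverts G" "v \<in> pverts G" for u v
    using U[OF f[OF that(1)] f[OF that(2)]] by blast
  moreover have "pair_wf_digraph G" "pair_wf_digraph H"
    using assms(13,15) unfolding geometric_1_graph_def
    by (simp_all add: pair_bidirected_digraph_def pair_sym_digraph_def)
  ultimately show ?thesis by (intro digraph_iso_with_projI)
qed

end
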